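(* Let $n\in\mathbb N$ and $L>0$, and let $\mathbb P_{L,n}$ be the probability measure on spatial partitions of $n$ with potential $V$ and weights $(\theta_j)_{j\ge1}$ defined in the context. (a) For every $\boldsymbol\eta=(\eta_x)_{x\in\mathbb Z^d}\in\mathbb N_0^{\mathbb Z^d}$ with $\sum_x\eta_x=n$, $$\mathbb P_{L,n}\bigl(\{\boldsymbol\lambda:\ \eta_x(\boldsymbol\lambda)=\eta_x\ \forall x\}\bigr)=\frac1{Z_{L,n}}\prod_{x\in\mathbb Z^d}\Bigl(h_{\eta_x}\,e^{-\eta_xV(x/L)}\Bigr).$$ (b) For every $\boldsymbol r=(r_j)_{j\ge1}\in\mathbb N_0^{\mathbb N}$ with $\sum_j j\,r_j=n$, $$\mathbb P_{L,n}\bigl(\{\boldsymbol\lambda:\ r_j(\boldsymbol\lambda)=r_j\ \forall j\}\bigr)=\frac1{Z_{L,n}}\prod_{j\ge1}\frac1{r_j!}\Bigl(\frac{\theta_j}{j}\sum_{x\in\mathbb Z^d}e^{-jV(x/L)}\Bigr)^{r_j}.$$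
   Context: Let $d\ge1$, $V:\mathbb R^d\to(-\infty,\infty]$, and let $(\theta_j)_{j\ge1}$ be non-negative numbers. A spatial partition of $n$ is a family $\boldsymbol\lambda=(\lambda_x)_{x\in\mathbb Z^d}$ of integer partitions (the empty partition is allowed) such that the sum of all parts over all $x$ equals $n$; $\Lambda_n$ is the (countable) set of spatial partitions of $n$. Let $r_{xj}(\boldsymbol\lambda)$ be the number of parts of $\lambda_x$ equal to $j$, $\eta_x(\boldsymbol\lambda)=\sum_{j\ge1}j\,r_{xj}(\boldsymbol\lambda)$, and $r_j(\boldsymbol\lambda)=\sum_{x\in\mathbb Z^d}r_{xj}(\boldsymbol\lambda)$. On $\Lambda_n$ define the probability measure $$\mathbb P_{L,n}(\boldsymbol\lambda)=\frac1{Z_{L,n}}\prod_{x\in\mathbb Z^d}\prod_{j\ge1}\frac1{r_{xj}(\boldsymbol\lambda)!}\Bigl(\frac{\theta_j}{j}e^{-jV(x/L)}\Bigr)^{r_{xj}(\boldsymbol\lambda)},$$ where $Z_{L,n}$ is the normalization, assumed to be finite (and non-zero, so that the measure is defined). Further, for $m\ge0$, $$h_m=\sum_{\lambda\vdash m}\prod_{j\ge1}\frac1{r_j(\lambda)!}\Bigl(\frac{\theta_j}{j}\Bigr)^{r_j(\lambda)},$$ where the sum is over integer partitions $\lambda$ of $m$ and $r_j(\lambda)$ is the number of parts of $\lambda$ equal to $j$; $h_0=1$. Conventions: $e^{-\infty}=0$, $e^{-0\cdot\infty}=1$, $0^0=\infty^0=1$, $0\cdot\infty=0$. *)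

theory Defs
  imports "HOL-Probability.Probability" "HOL-Library.Groups_Big_Fun"
begin

text \<open>
  Weights, partition functions and probabilities take values in \<^typ>\<open>ennreal\<close>, where
  \<open>0 * \<infinity> = 0\<close> and \<open>0 ^ 0 = \<infinity> ^ 0 = 1\<close>. Products over infinite index sets are written with
  \<^const>\<open>Prod_any\<close>: on spatial partitions of \<open>n\<close>, and on families summing to \<open>n\<close>, only finitely
  many factors differ from 1. The weights \<open>\<theta> j\<close> are meant to be non-negative for \<open>j \<ge> 1\<close>
  (\<^const>\<open>ennreal\<close> truncates negative reals to 0), and \<open>\<theta> 0\<close> is never used.
\<close>

definition eexp :: "ereal \<Rightarrow> ennreal" where
  "eexp v = (case v of ereal s \<Rightarrow> ennreal (exp s) | PInfty \<Rightarrow> \<infinity> | MInfty \<Rightarrow> 0)"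

definition scaled_site :: "real \<Rightarrow> int ^ 'd \<Rightarrow> real ^ 'd::finite" where
  "scaled_site L x = (\<chi> i. real_of_int (x $ i) / L)"

definition boltzmann :: "(real ^ 'd::finite \<Rightarrow> ereal) \<Rightarrow> real \<Rightarrow> nat \<Rightarrow> int ^ 'd \<Rightarrow> ennreal" where
  "boltzmann V L m x = eexp (- (ereal (real m) * V (scaled_site L x)))"

text \<open>An integer partition is the multiset of its parts; \<^term>\<open>count p j\<close> is \<open>r\<^sub>j\<close>.\<close>

definition integer_partition :: "nat multiset \<Rightarrow> bool" where
  "integer_partition p \<longleftrightarrow> 0 \<notin># p"

text \<open>
  Convergence in the discrete space \<^typ>\<open>nat\<close> forces all but finitely many \<^term>\<open>\<Lambda> x\<close> to be empty.
\<close>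

definition spatial_partitions :: "nat \<Rightarrow> (int ^ 'd::finite \<Rightarrow> nat multiset) set" where
  "spatial_partitions n =
     {\<Lambda>. (\<forall>x. integer_partition (\<Lambda> x)) \<and> ((\<lambda>x. \<Sum>\<^sub># (\<Lambda> x)) has_sum n) UNIV}"

definition site_mass :: "(int ^ 'd::finite \<Rightarrow> nat multiset) \<Rightarrow> int ^ 'd \<Rightarrow> nat" where
  "site_mass \<Lambda> x = (\<Sum>\<^sub>\<infinity>j\<in>{1..}. j * count (\<Lambda> x) j)"

definition total_count :: "(int ^ 'd::finite \<Rightarrow> nat multiset) \<Rightarrow> nat \<Rightarrow> nat" where
  "total_count \<Lambda> j = (\<Sum>\<^sub>\<infinity>x. count (\<Lambda> x) j)"

definition spatial_weight ::
  "(real ^ 'd::finite \<Rightarrow> ereal) \<Rightarrow> (nat \<Rightarrow> real) \<Rightarrow> real \<Rightarrow> (int ^ 'd \<Rightarrow> nat multiset) \<Rightarrow> ennreal" where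
  "spatial_weight V \<theta> L \<Lambda> =
     (Prod_any (\<lambda>x. Prod_any (\<lambda>j. if j \<ge> 1
        then 1 / of_nat (fact (count (\<Lambda> x) j)) *
             (ennreal (\<theta> j / real j) * boltzmann V L j x) ^ count (\<Lambda> x) j
        else 1)))"

definition partition_function ::
  "(real ^ 'd::finite \<Rightarrow> ereal) \<Rightarrow> (nat \<Rightarrow> real) \<Rightarrow> real \<Rightarrow> nat \<Rightarrow> ennreal" where
  "partition_function V \<theta> L n = (\<Sum>\<^sub>\<infinity>\<Lambda>\<in>spatial_partitions n. spatial_weight V \<theta> L \<Lambda>)"

definition spatial_measure ::
  "(real ^ 'd::finite \<Rightarrow> ereal) \<Rightarrow> (nat \<Rightarrow> real) \<Rightarrow> real \<Rightarrow> nat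
     \<Rightarrow> (int ^ 'd \<Rightarrow> nat multiset) measure" where
  "spatial_measure V \<theta> L n =
     point_measure (spatial_partitions n)
       (\<lambda>\<Lambda>. 1 / partition_function V \<theta> L n * spatial_weight V \<theta> L \<Lambda>)"

definition h_weight :: "(nat \<Rightarrow> real) \<Rightarrow> nat \<Rightarrow> ennreal" where
  "h_weight \<theta> m =
     (\<Sum>p | integer_partition p \<and> \<Sum>\<^sub># p = m.
        Prod_any (\<lambda>j. if j \<ge> 1
          then 1 / of_nat (fact (count p j)) * ennreal (\<theta> j / real j) ^ count p j
          else 1))"

lemma nn_integral_count_space_eq_infsum:
  fixes f :: "'a \<Rightarrow> ennreal"
  shows "(\<integral>\<^sup>+x. f x \<partial>count_space A) = (\<Sum>\<^sub>\<infinity>x\<in>A. f x)"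
proof (rule antisym)
  show "(\<integral>\<^sup>+x. f x \<partial>count_space A) \<le> (\<Sum>\<^sub>\<infinity>x\<in>A. f x)"
    unfolding nn_integral_def
  proof (rule SUP_least)
    fix g assume "g \<in> {g. simple_function (count_space A) g \<and> g \<le> f}"
    then have g: "simple_function (count_space A) g" "g \<le> f"
      by auto
    define S where "S = {x \<in> A. g x \<noteq> 0}"
    show "integral\<^sup>S (count_space A) g \<le> (\<Sum>\<^sub>\<infinity>x\<in>A. f x)"
    proof (cases "finite S")
      case True
      have "integral\<^sup>S (count_space A) g = (\<Sum>x\<in>S. g x)"
        using g(1) True nn_integral_count_space[of A g]
        by (simp add: nn_integral_eq_simple_integral[symmetric] S_def zero_less_iff_neq_zero)
      also have "\<dots> \<le> (\<Sum>x\<in>S. f x)"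
        using g(2) by (auto intro!: sum_mono simp: le_fun_def)
      also have "\<dots> = (\<Sum>\<^sub>\<infinity>x\<in>S. f x)"
        using True by simp
      also have "\<dots> \<le> (\<Sum>\<^sub>\<infinity>x\<in>A. f x)"
        by (rule infsum_mono_neutral) (auto simp: S_def intro: nonneg_summable_on_complete)
      finally show ?thesis .
    next
      case False
      have fin: "finite (g ` S)"
        using g(1) by (auto simp: simple_function_def S_def intro: finite_subset[of _ "g ` A"])
      define c where "c = Min (g ` S)"
      have "c \<in> g ` S"
        using False fin by (auto simp: c_def intro!: Min_in)
      then have "c > 0"
        by (auto simp: S_def zero_less_iff_neq_zero)
      moreover have "c \<le> f x" if "x \<in> S" for x
        using that g(2) fin by (auto simp: c_def le_fun_def intro: Min.coboundedI order_trans)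
      ultimately have "(\<Sum>\<^sub>\<infinity>x\<in>S. f x) = \<infinity>"
        using False by (intro infsum_superconst_infinite_ennreal[of S c]) auto
      moreover have "(\<Sum>\<^sub>\<infinity>x\<in>S. f x) \<le> (\<Sum>\<^sub>\<infinity>x\<in>A. f x)"
        by (rule infsum_mono_neutral) (auto simp: S_def intro: nonneg_summable_on_complete)
      ultimately show ?thesis
        by (simp add: top_unique)
    qed
  qed
  show "(\<Sum>\<^sub>\<infinity>x\<in>A. f x) \<le> (\<integral>\<^sup>+x. f x \<partial>count_space A)"
  proof (rule infsum_le_finite_sums)
    show "f summable_on A"
      by (simp add: nonneg_summable_on_complete)
  next
    fix F assume F: "finite F" "F \<subseteq> A"
    have "sum f F = (\<integral>\<^sup>+x. f x * indicator F x \<partial>count_space A)"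
      using F by (subst nn_integral_count_space'[of F]) (auto simp: indicator_def)
    also have "\<dots> \<le> (\<integral>\<^sup>+x. f x \<partial>count_space A)"
      by (intro nn_integral_mono) (auto simp: indicator_def)
    finally show "sum f F \<le> (\<integral>\<^sup>+x. f x \<partial>count_space A)" .
  qed
qed

lemma prob_space_spatial_measure:
  assumes "partition_function V \<theta> L n \<noteq> 0" "partition_function V \<theta> L n \<noteq> \<infinity>"
  shows "prob_space (spatial_measure V \<theta> L n)"
proof
  let ?Z = "partition_function V \<theta> L n"
  have "emeasure (spatial_measure V \<theta> L n) (spatial_partitions n) =
        (\<integral>\<^sup>+\<Lambda>. 1 / ?Z * spatial_weight V \<theta> L \<Lambda> \<partial>count_space (spatial_partitions n))"
    unfolding spatial_measure_def point_measure_def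
    by (subst emeasure_density) (auto intro!: nn_integral_cong)
  also have "\<dots> = 1 / ?Z * ?Z"
    by (subst nn_integral_cmult) (simp_all add: partition_function_def nn_integral_count_space_eq_infsum)
  also have "\<dots> = 1"
    using assms by (simp add: ennreal_divide_times ennreal_divide_self top.not_eq_extremum)
  finally show "emeasure (spatial_measure V \<theta> L n) (space (spatial_measure V \<theta> L n)) = 1"
    by (simp add: spatial_measure_def space_point_measure)
qed

end

theory Submission
  imports Defs "HOL-Combinatorics.Multiset_Permutations"
begin

text \<open>
  Give a multiset \<open>M\<close> with weights \<open>w\<close> on its elements the value
  \<open>\<Prod>\<^sub>a w(a)\<^bsup>count M a\<^esup> / (count M a)!\<close>. A spatial partition is a finite matrix of multiplicities
  \<open>r\<^sub>x\<^sub>j\<close>, and its weight is the product over all entries of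
  \<open>(\<theta>\<^sub>j/j e\<^bsup>-jV(x/L)\<^esup>)\<^bsup>r\<^sub>x\<^sub>j\<^esup> / r\<^sub>x\<^sub>j!\<close>: the multiset value of its rows, multiplied over the sites
  \<open>x\<close>, or equally the multiset value of its columns, multiplied over the part sizes \<open>j\<close>. Each marginal
  fixes one quantity per row, or one per column, so that the set summed over is a product set. The sum of
  a product over a product set is the product of the sums
  (\<open>infsum_prod_families_ennreal\<close>), and one factor remains to be computed in each case.

  Rows: \<open>\<lambda>\<^sub>x\<close> runs over the integer partitions of \<open>\<eta>\<^sub>x\<close>. Since \<open>e\<^bsup>-jV\<^esup> = (e\<^bsup>-V\<^esup>)\<^sup>j\<close>, each of
  them carries the same Boltzmann factor \<open>e\<^bsup>-\<eta>\<^sub>xV(x/L)\<^esup>\<close>, and what is left sums to \<open>h\<close> at \<open>\<eta>\<^sub>x\<close>.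

  Columns: column \<open>j\<close> is a multiset of sites of size \<open>r\<^sub>j\<close>, and the multinomial theorem with infinitely
  many variables (\<open>infsum_multiset_weight_size\<close>) gives \<open>(\<Sum>\<^sub>x w(x))\<^bsup>r\<^sub>j\<^esup> / r\<^sub>j!\<close>. Passing from rows to
  columns is the transposition of a finitely supported family of multisets
  (\<open>bij_betw_transpose_spatial_partitions\<close>).

  All of this takes place in the extended non-negative reals, where sums may be rearranged freely, so
  that the column identity also covers an infinite value of \<open>\<Sum>\<^sub>x e\<^bsup>-jV(x/L)\<^esup>\<close>.
\<close>

section \<open>Infinite sums of extended non-negative reals\<close>

lemma infsum_cmult_ennreal:
  fixes f :: "'a \<Rightarrow> ennreal"
  shows "(\<Sum>\<^sub>\<infinity>x\<in>A. c * f x) = c * (\<Sum>\<^sub>\<infinity>x\<in>A. f x)"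
  by (simp add: nn_integral_cmult flip: nn_integral_count_space_eq_infsum)

text \<open>
  Tonelli's theorem for counting measures: sums of extended non-negative reals are integrals over
  counting measures, and non-negative integrals may be iterated without any countability assumption.
\<close>

lemma infsum_Sigma_ennreal:
  fixes f :: "'a \<Rightarrow> 'b \<Rightarrow> ennreal"
  shows "(\<Sum>\<^sub>\<infinity>(x, y)\<in>Sigma A B. f x y) = (\<Sum>\<^sub>\<infinity>x\<in>A. \<Sum>\<^sub>\<infinity>y\<in>B x. f x y)"
proof -
  let ?g = "\<lambda>z. case z of (x, y) \<Rightarrow> f x y * indicator (Sigma A B) (x, y)"
  have "(\<Sum>\<^sub>\<infinity>(x, y)\<in>Sigma A B. f x y) = integral\<^sup>N (count_space UNIV) ?g"
    unfolding nn_integral_count_space_eq_infsum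
    by (rule infsum_cong_neutral) (auto simp: indicator_def)
  also have "\<dots> = (\<Sum>\<^sub>\<infinity>x. \<Sum>\<^sub>\<infinity>y. ?g (x, y))"
    by (simp only: nn_integral_fst_count_space flip: nn_integral_count_space_eq_infsum)
  also have "\<dots> = (\<Sum>\<^sub>\<infinity>x\<in>A. \<Sum>\<^sub>\<infinity>y. ?g (x, y))"
    by (rule infsum_cong_neutral) (auto simp: indicator_def intro!: infsum_0)
  also have "\<dots> = (\<Sum>\<^sub>\<infinity>x\<in>A. \<Sum>\<^sub>\<infinity>y\<in>B x. f x y)"
    by (intro infsum_cong infsum_cong_neutral) (auto simp: indicator_def)
  finally show ?thesis .
qed

lemma infsum_Times_mult_ennreal:
  fixes f :: "'a \<Rightarrow> ennreal" and g :: "'b \<Rightarrow> ennreal"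
  shows "(\<Sum>\<^sub>\<infinity>(x, y)\<in>A \<times> B. f x * g y) = (\<Sum>\<^sub>\<infinity>x\<in>A. f x) * (\<Sum>\<^sub>\<infinity>y\<in>B. g y)"
  by (simp add: infsum_Sigma_ennreal infsum_cmult_ennreal mult.commute[of _ "infsum g B"])

lemma infsum_fibres_ennreal:
  fixes f :: "'a \<Rightarrow> ennreal"
  assumes "g ` A \<subseteq> B"
  shows "(\<Sum>\<^sub>\<infinity>x\<in>A. f x) = (\<Sum>\<^sub>\<infinity>y\<in>B. \<Sum>\<^sub>\<infinity>x | x \<in> A \<and> g x = y. f x)"
proof -
  have "(\<Sum>\<^sub>\<infinity>x\<in>A. f x) = (\<Sum>\<^sub>\<infinity>(y, x)\<in>(SIGMA y:B. {x. x \<in> A \<and> g x = y}). f x)"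
    by (rule infsum_reindex_bij_witness[where j = "\<lambda>x. (g x, x)" and i = snd]) (use assms in auto)
  then show ?thesis
    by (simp add: infsum_Sigma_ennreal)
qed

text \<open>
  Distributivity of a finite product over infinite sums. The families are total functions pinned to a
  default \<open>d\<close> outside \<open>S\<close>; with \<open>d\<close> the empty multiset they become the families of multisets supported
  in \<open>S\<close> that both marginals sum over. Induction on \<open>S\<close> splits off one coordinate at a time.
\<close>

lemma infsum_prod_families_ennreal:
  fixes f :: "'a \<Rightarrow> 'b \<Rightarrow> ennreal"
  assumes "finite S"
  shows "(\<Sum>\<^sub>\<infinity>\<phi> | (\<forall>x\<in>S. \<phi> x \<in> B x) \<and> (\<forall>x. x \<notin> S \<longrightarrow> \<phi> x = d). \<Prod>x\<in>S. f x (\<phi> x))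
       = (\<Prod>x\<in>S. \<Sum>\<^sub>\<infinity>y\<in>B x. f x y)"
  using assms
proof (induction S rule: finite_induct)
  case empty
  have "{\<phi>. \<forall>x. \<phi> x = d} = {\<lambda>_::'a. d}"
    by auto
  then show ?case
    by simp
next
  case (insert a S)
  let ?F = "\<lambda>S. {\<phi>. (\<forall>x\<in>S. \<phi> x \<in> B x) \<and> (\<forall>x. x \<notin> S \<longrightarrow> \<phi> x = d)}"
  have "(\<Sum>\<^sub>\<infinity>\<phi>\<in>?F (insert a S). \<Prod>x\<in>insert a S. f x (\<phi> x))
      = (\<Sum>\<^sub>\<infinity>(y, \<phi>)\<in>B a \<times> ?F S. f a y * (\<Prod>x\<in>S. f x (\<phi> x)))"
  proof (rule infsum_reindex_bij_witness
      [where j = "\<lambda>\<phi>. (\<phi> a, \<phi>(a := d))" and i = "\<lambda>(y, \<phi>). \<phi>(a := y)"])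
    fix \<phi> assume "\<phi> \<in> ?F (insert a S)"
    have "(\<Prod>x\<in>S. f x ((\<phi>(a := d)) x)) = (\<Prod>x\<in>S. f x (\<phi> x))"
      by (rule prod.cong) (use insert.hyps in auto)
    then show "(case (\<phi> a, \<phi>(a := d)) of (y, \<phi>) \<Rightarrow> f a y * (\<Prod>x\<in>S. f x (\<phi> x)))
        = (\<Prod>x\<in>insert a S. f x (\<phi> x))"
      using insert.hyps by simp
  qed (use insert.hyps in auto)
  also have "\<dots> = (\<Prod>x\<in>insert a S. \<Sum>\<^sub>\<infinity>y\<in>B x. f x y)"
    using insert by (simp add: infsum_Times_mult_ennreal)
  finally show ?case .
qed

text \<open>
  In a discrete space a convergent net is eventually constant, so only finitely many terms can be
  non-zero.
\<close>

lemma has_sum_nat_iff: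
  fixes f :: "'a \<Rightarrow> nat"
  shows "(f has_sum n) A \<longleftrightarrow> finite {x\<in>A. f x \<noteq> 0} \<and> (\<Sum>x | x \<in> A \<and> f x \<noteq> 0. f x) = n"
proof -
  have "(f has_sum n) A \<longleftrightarrow> (f has_sum n) {x\<in>A. f x \<noteq> 0}"
    by (rule has_sum_cong_neutral) auto
  moreover have "finite {x\<in>A. f x \<noteq> 0}" if "(f has_sum n) A"
    using that summable_on_discrete_iff[of f A] by (auto simp: summable_on_def)
  ultimately show ?thesis
    by (cases "finite {x\<in>A. f x \<noteq> 0}") (simp_all only: has_sum_finite_iff, auto)
qed

section \<open>Weights of multisets\<close>

lemma sum_mset_eq_sum_count:
  fixes f :: "'a \<Rightarrow> nat"
  assumes "finite S" "set_mset M \<subseteq> S"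
  shows "(\<Sum>a\<in>#M. f a) = (\<Sum>a\<in>S. f a * count M a)"
  using assms(2)
proof (induction M)
  case (add x M)
  have "(\<Sum>a\<in>S. f a * count (add_mset x M) a) = (\<Sum>a\<in>S. (if a = x then f x else 0) + f a * count M a)"
    by (rule sum.cong) auto
  also have "\<dots> = f x + (\<Sum>a\<in>S. f a * count M a)"
    using assms(1) add.prems by (simp add: sum.distrib)
  finally show ?case
    using add by simp
qed simp

lemma fact_mult_inverse_ennreal:
  "of_nat (fact k) * (1 / of_nat (fact k)) = (1 :: ennreal)"
proof -
  have "of_nat (fact k) \<noteq> (0 :: ennreal)" "of_nat (fact k) < (\<top> :: ennreal)"
    by (simp_all only: of_nat_less_top of_nat_eq_0_iff fact_nonzero not_False_eq_True)
  then show ?thesis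
    by (simp only: ennreal_times_divide mult_1_right ennreal_divide_self not_False_eq_True)
qed

definition multiset_weight :: "('a \<Rightarrow> ennreal) \<Rightarrow> 'a multiset \<Rightarrow> ennreal" where
  "multiset_weight w M = (\<Prod>a\<in>set_mset M. 1 / of_nat (fact (count M a)) * w a ^ count M a)"

lemma multiset_weight_superset:
  assumes "finite S" "set_mset M \<subseteq> S"
  shows "multiset_weight w M = (\<Prod>a\<in>S. 1 / of_nat (fact (count M a)) * w a ^ count M a)"
  unfolding multiset_weight_def
  by (rule prod.mono_neutral_left) (use assms in \<open>auto simp: not_in_iff\<close>)

lemma multiset_weight_empty [simp]: "multiset_weight w {#} = 1"
  by (simp add: multiset_weight_def)

text \<open>
  A factor of the form \<open>b\<^bsup>f(a)\<^esup>\<close> contributes only through the total of \<open>f\<close>. For \<open>f\<close> the identity on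
  part sizes this makes the Boltzmann factor the same for all partitions of a given number.
\<close>

lemma multiset_weight_mult_power:
  "multiset_weight (\<lambda>a. t a * b ^ f a) M = multiset_weight t M * b ^ (\<Sum>a\<in>#M. f a)"
proof -
  have "(\<Sum>a\<in>#M. f a) = (\<Sum>a\<in>set_mset M. f a * count M a)"
    by (simp add: sum_mset_eq_sum_count)
  then show ?thesis
    by (simp add: multiset_weight_def power_mult_distrib power_sum power_mult mult.assoc flip: prod.distrib)
qed

lemma Prod_any_eq_multiset_weight:
  assumes "0 \<notin># p"
  shows "Prod_any (\<lambda>j. if j \<ge> 1 then 1 / of_nat (fact (count p j)) * w j ^ count p j else 1)
       = multiset_weight w (p :: nat multiset)"
proof -
  have "{j. (if j \<ge> 1 then 1 / of_nat (fact (count p j)) * w j ^ count p j else 1) \<noteq> 1} \<subseteq> set_mset p"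
  proof (rule subsetI, rule ccontr)
    fix j assume j: "j \<in> {j. (if j \<ge> 1 then 1 / of_nat (fact (count p j)) * w j ^ count p j else 1) \<noteq> 1}"
    assume "j \<notin># p"
    then have "count p j = 0"
      by (simp only: not_in_iff)
    then show False
      using j by (simp split: if_splits)
  qed
  then show ?thesis
    unfolding multiset_weight_def
    by (subst Prod_any.expand_superset[of "set_mset p"])
       (use assms in \<open>auto intro!: prod.cong simp: not_less_eq_eq\<close>)
qed

lemma power_infsum_ennreal:
  fixes w :: "'a \<Rightarrow> ennreal"
  shows "(\<Sum>\<^sub>\<infinity>x. w x) ^ k = (\<Sum>\<^sub>\<infinity>xs | length xs = k. prod_list (map w xs))"
proof (induction k)
  case (Suc k)
  have "(\<Sum>\<^sub>\<infinity>xs | length xs = Suc k. prod_list (map w xs))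
      = (\<Sum>\<^sub>\<infinity>(x, xs)\<in>UNIV \<times> {xs. length xs = k}. w x * prod_list (map w xs))"
    by (rule infsum_reindex_bij_witness[where j = "\<lambda>xs. (hd xs, tl xs)" and i = "\<lambda>(x, xs). x # xs"])
       (auto simp: length_Suc_conv)
  then show ?case
    by (simp add: infsum_Times_mult_ennreal Suc.IH)
qed simp

text \<open>
  The product along a list depends only on its multiset, and a multiset has
  \<open>(size M)! / \<Prod>\<^sub>a (count M a)!\<close> orderings.
\<close>

lemma sum_permutations_eq_multiset_weight:
  "(\<Sum>xs\<in>permutations_of_multiset M. prod_list (map w xs)) = fact (size M) * multiset_weight w M"
proof -
  let ?P = "\<Prod>a\<in>set_mset M. fact (count M a) :: nat"
  have "prod_list (map w xs) = (\<Prod>a\<in>set_mset M. w a ^ count M a)"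
    if "xs \<in> permutations_of_multiset M" for xs
    using that by (auto simp: image_prod_mset_multiplicity permutations_of_multiset_def
        simp flip: prod_mset_prod_list)
  then have "(\<Sum>xs\<in>permutations_of_multiset M. prod_list (map w xs))
      = of_nat (card (permutations_of_multiset M)) * (\<Prod>a\<in>set_mset M. w a ^ count M a)"
    by simp
  also have "(\<Prod>a\<in>set_mset M. w a ^ count M a)
      = (\<Prod>a\<in>set_mset M. of_nat (fact (count M a)) * (1 / of_nat (fact (count M a)) * w a ^ count M a))"
    by (simp only: fact_mult_inverse_ennreal mult_1_left flip: mult.assoc)
  also have "\<dots> = of_nat ?P * multiset_weight w M"
    by (simp only: prod.distrib multiset_weight_def of_nat_prod)
  also have "of_nat (card (permutations_of_multiset M)) * (of_nat ?P * multiset_weight w M)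
      = of_nat (card (permutations_of_multiset M) * ?P) * multiset_weight w M"
    by (simp only: of_nat_mult mult.assoc)
  also have "\<dots> = fact (size M) * multiset_weight w M"
    by (simp only: card_permutations_of_multiset_aux of_nat_fact)
  finally show ?thesis .
qed

text \<open>
  Expanding the power gives a sum over lists of length \<open>k\<close>; grouping the lists by their multisets turns it
  into the multinomial theorem, with possibly infinitely many variables.
\<close>

lemma infsum_multiset_weight_size:
  fixes w :: "'a \<Rightarrow> ennreal"
  shows "(\<Sum>\<^sub>\<infinity>M | size M = k. multiset_weight w M) = 1 / of_nat (fact k) * (\<Sum>\<^sub>\<infinity>x. w x) ^ k"
proof -
  have "(\<Sum>\<^sub>\<infinity>x. w x) ^ k
      = (\<Sum>\<^sub>\<infinity>M | size M = k. \<Sum>\<^sub>\<infinity>xs | xs \<in> {xs. length xs = k} \<and> mset xs = M. prod_list (map w xs))"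
    unfolding power_infsum_ennreal by (rule infsum_fibres_ennreal) auto
  also have "\<dots> = (\<Sum>\<^sub>\<infinity>M | size M = k. of_nat (fact k) * multiset_weight w M)"
  proof (rule infsum_cong)
    fix M :: "'a multiset" assume "M \<in> {M. size M = k}"
    then have "{xs. xs \<in> {xs. length xs = k} \<and> mset xs = M} = permutations_of_multiset M" "size M = k"
      by (auto simp: permutations_of_multiset_def)
    then show "(\<Sum>\<^sub>\<infinity>xs | xs \<in> {xs. length xs = k} \<and> mset xs = M. prod_list (map w xs))
        = of_nat (fact k) * multiset_weight w M"
      using sum_permutations_eq_multiset_weight[of w M] by simp
  qed
  also have "\<dots> = of_nat (fact k) * (\<Sum>\<^sub>\<infinity>M | size M = k. multiset_weight w M)"
    by (rule infsum_cmult_ennreal)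
  finally have "1 / of_nat (fact k) * (\<Sum>\<^sub>\<infinity>x. w x) ^ k
      = (1 / of_nat (fact k) * of_nat (fact k)) * (\<Sum>\<^sub>\<infinity>M | size M = k. multiset_weight w M)"
    by (simp only: mult.assoc)
  then show ?thesis
    by (simp only: fact_mult_inverse_ennreal mult.commute[of "1 / _" "of_nat (fact k)"] mult_1_left)
qed

section \<open>Transposing families of multisets\<close>

text \<open>
  A family of multisets is a matrix of multiplicities; this is the transposed matrix. It is meaningful
  for families with finitely many non-empty members, where every column is finite.
\<close>

definition transpose_mset :: "('a \<Rightarrow> 'b multiset) \<Rightarrow> 'b \<Rightarrow> 'a multiset" where
  "transpose_mset \<Lambda> b = Abs_multiset (\<lambda>a. count (\<Lambda> a) b)"

lemma count_transpose_mset: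
  assumes "finite {a. \<Lambda> a \<noteq> {#}}"
  shows "count (transpose_mset \<Lambda> b) a = count (\<Lambda> a) b"
proof -
  have "{a. 0 < count (\<Lambda> a) b} \<subseteq> {a. \<Lambda> a \<noteq> {#}}"
    by auto
  then have "finite {a. 0 < count (\<Lambda> a) b}"
    using assms finite_subset by blast
  then show ?thesis
    by (simp add: transpose_mset_def count_Abs_multiset)
qed

lemma finite_support_transpose_mset:
  assumes "finite {a. \<Lambda> a \<noteq> {#}}"
  shows "finite {b. transpose_mset \<Lambda> b \<noteq> {#}}"
proof (rule finite_subset)
  show "{b. transpose_mset \<Lambda> b \<noteq> {#}} \<subseteq> (\<Union>a\<in>{a. \<Lambda> a \<noteq> {#}}. set_mset (\<Lambda> a))"
  proof safe
    fix b assume "transpose_mset \<Lambda> b \<noteq> {#}"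
    then obtain a where "a \<in># transpose_mset \<Lambda> b"
      by blast
    then have "b \<in># \<Lambda> a"
      using count_transpose_mset[OF assms, of b a] by (simp flip: count_greater_zero_iff)
    then show "b \<in> (\<Union>a\<in>{a. \<Lambda> a \<noteq> {#}}. set_mset (\<Lambda> a))"
      by (auto intro!: exI[of _ a])
  qed
qed (use assms in auto)

lemma transpose_transpose_mset:
  assumes "finite {a. \<Lambda> a \<noteq> {#}}"
  shows "transpose_mset (transpose_mset \<Lambda>) = \<Lambda>"
  using assms by (intro ext multiset_eqI) (simp add: count_transpose_mset finite_support_transpose_mset)

text \<open>
  Both sides multiply the same factors over the entries of a matrix; enlarging the supports to \<open>A\<close> and
  \<open>B\<close> only adds factors 1 and makes the index set a rectangle.
\<close>

lemma prod_multiset_weight_transpose: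
  assumes "finite {a. \<Lambda> a \<noteq> {#}}" "finite A" "{a. \<Lambda> a \<noteq> {#}} \<subseteq> A"
    and "finite B" "{b. transpose_mset \<Lambda> b \<noteq> {#}} \<subseteq> B"
  shows "(\<Prod>a\<in>A. multiset_weight (w a) (\<Lambda> a))
       = (\<Prod>b\<in>B. multiset_weight (\<lambda>a. w a b) (transpose_mset \<Lambda> b))"
proof -
  note count = count_transpose_mset[OF assms(1)]
  have mem: "b \<in># \<Lambda> a \<longleftrightarrow> a \<in># transpose_mset \<Lambda> b" for a b
    by (simp add: count flip: count_greater_zero_iff)
  have "set_mset (\<Lambda> a) \<subseteq> B" for a
    using assms(5) by (auto simp: mem)
  moreover have "set_mset (transpose_mset \<Lambda> b) \<subseteq> A" for b
    using assms(3) by (auto simp flip: mem)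
  ultimately have "(\<Prod>a\<in>A. multiset_weight (w a) (\<Lambda> a))
      = (\<Prod>a\<in>A. \<Prod>b\<in>B. 1 / of_nat (fact (count (\<Lambda> a) b)) * w a b ^ count (\<Lambda> a) b)"
    and "(\<Prod>b\<in>B. multiset_weight (\<lambda>a. w a b) (transpose_mset \<Lambda> b))
      = (\<Prod>b\<in>B. \<Prod>a\<in>A. 1 / of_nat (fact (count (\<Lambda> a) b)) * w a b ^ count (\<Lambda> a) b)"
    using assms(2,4) by (simp_all only: multiset_weight_superset[of B] multiset_weight_superset[of A] count)
  then show ?thesis
    by (simp only: prod.swap[of _ A B])
qed

section \<open>Integer partitions and spatial partitions\<close>

lemma sum_mset_eq_0_iff_integer_partition:
  assumes "integer_partition p"
  shows "\<Sum>\<^sub># p = 0 \<longleftrightarrow> p = {#}"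
  using assms by (cases p) (auto simp: integer_partition_def)

text \<open>
  Both the number of parts and the parts themselves are bounded by the sum, as no part is 0. Finiteness
  is what makes the finite sum defining \<open>h\<close> agree with the corresponding infinite sum.
\<close>

lemma finite_integer_partitions: "finite {p. integer_partition p \<and> \<Sum>\<^sub># p = m}"
proof (rule finite_subset)
  have size_le: "size p \<le> \<Sum>\<^sub># p" if "0 \<notin># p" for p :: "nat multiset"
    using that by (induction p) auto
  have "x \<le> \<Sum>\<^sub># p" if "x \<in># p" for x and p :: "nat multiset"
    using that by (metis le_add1 multi_member_split sum_mset.add_mset)
  then show "{p. integer_partition p \<and> \<Sum>\<^sub># p = m} \<subseteq> (\<Union>k\<le>m. multisets_of_size {..m} k)"
    using size_le by (auto simp: integer_partition_def multisets_of_size_def)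
qed auto

lemma h_weight_eq:
  "h_weight \<theta> m
    = (\<Sum>p | integer_partition p \<and> \<Sum>\<^sub># p = m. multiset_weight (\<lambda>j. ennreal (\<theta> j / real j)) p)"
  unfolding h_weight_def
  by (rule sum.cong) (use Prod_any_eq_multiset_weight in \<open>auto simp: integer_partition_def\<close>)

lemma h_weight_0: "h_weight \<theta> 0 = 1"
proof -
  have "{p. integer_partition p \<and> \<Sum>\<^sub># p = 0} = {{#}}"
    using sum_mset_eq_0_iff_integer_partition by (auto simp: integer_partition_def)
  then show ?thesis
    by (simp add: h_weight_eq)
qed

text \<open>
  At infinite values of the potential this rests on the conventions \<open>0 * \<infinity> = 0\<close> and
  \<open>0\<^sup>0 = \<infinity>\<^sup>0 = 1\<close>, which agree at \<open>m = 0\<close>.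
\<close>

lemma boltzmann_power: "boltzmann V L m x = boltzmann V L 1 x ^ m"
proof (cases "V (scaled_site L x)")
  case (real v)
  have "exp (- (real m * v)) = exp (- v) ^ m"
    by (simp flip: exp_of_nat_mult)
  then show ?thesis
    using real by (simp add: boltzmann_def eexp_def ennreal_power)
next
  case PInf
  then show ?thesis
    by (cases "m = 0") (simp_all add: boltzmann_def eexp_def zero_ereal_def flip: infinity_ereal_def)
next
  case MInf
  then show ?thesis
    by (cases "m = 0")
       (simp_all add: boltzmann_def eexp_def zero_ereal_def power_eq_top_ennreal flip: infinity_ereal_def)
qed

lemma boltzmann_0: "boltzmann V L 0 x = 1"
proof -
  have "boltzmann V L 0 x = eexp (ereal 0)"
    by (simp add: boltzmann_def flip: zero_ereal_def)
  then show ?thesis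
    by (simp only: eexp_def ereal.case exp_zero ennreal_1)
qed

text \<open>
  As no part is 0, a site of mass 0 carries the empty partition, so the finitely many sites of positive
  mass are the support of the family.
\<close>

lemma spatial_partitions_iff:
  "\<Lambda> \<in> spatial_partitions n \<longleftrightarrow>
     (\<forall>x. integer_partition (\<Lambda> x)) \<and> finite {x. \<Lambda> x \<noteq> {#}} \<and> (\<Sum>x | \<Lambda> x \<noteq> {#}. \<Sum>\<^sub># (\<Lambda> x)) = n"
  unfolding spatial_partitions_def mem_Collect_eq
proof (rule conj_cong[OF refl])
  assume "\<forall>x. integer_partition (\<Lambda> x)"
  then have "\<Sum>\<^sub># (\<Lambda> x) \<noteq> 0 \<longleftrightarrow> \<Lambda> x \<noteq> {#}" for x
    by (simp only: sum_mset_eq_0_iff_integer_partition)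
  then show "((\<lambda>x. \<Sum>\<^sub># (\<Lambda> x)) has_sum n) UNIV
      \<longleftrightarrow> finite {x. \<Lambda> x \<noteq> {#}} \<and> (\<Sum>x | \<Lambda> x \<noteq> {#}. \<Sum>\<^sub># (\<Lambda> x)) = n"
    by (simp only: has_sum_nat_iff UNIV_I simp_thms)
qed

lemma site_mass_eq: "site_mass \<Lambda> x = \<Sum>\<^sub># (\<Lambda> x)"
proof -
  have "j * count (\<Lambda> x) j = 0" if "j \<notin> {1..}" for j
    using that by (cases j) simp_all
  then have "site_mass \<Lambda> x = (\<Sum>\<^sub>\<infinity>j\<in>set_mset (\<Lambda> x). j * count (\<Lambda> x) j)"
    unfolding site_mass_def by (intro infsum_cong_neutral) (simp_all add: count_eq_zero_iff)
  also have "\<dots> = (\<Sum>j\<in>set_mset (\<Lambda> x). j * count (\<Lambda> x) j)"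
    by (rule infsum_finite) (rule finite_set_mset)
  also have "\<dots> = \<Sum>\<^sub># (\<Lambda> x)"
    using sum_mset_eq_sum_count[of "set_mset (\<Lambda> x)" "\<Lambda> x" "\<lambda>j. j"] by simp
  finally show ?thesis .
qed

lemma total_count_eq:
  assumes "finite {x. \<Lambda> x \<noteq> {#}}"
  shows "total_count \<Lambda> j = size (transpose_mset \<Lambda> j)"
proof -
  have "total_count \<Lambda> j = (\<Sum>\<^sub>\<infinity>x\<in>set_mset (transpose_mset \<Lambda> j). count (transpose_mset \<Lambda> j) x)"
    unfolding total_count_def
    by (rule infsum_cong_neutral) (simp_all flip: count_transpose_mset[OF assms] add: count_eq_zero_iff)
  then show ?thesis
    by (simp add: size_multiset_overloaded_eq)
qed

lemma spatial_weight_eq: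
  assumes "\<And>x. integer_partition (\<Lambda> x)" "finite S" "{x. \<Lambda> x \<noteq> {#}} \<subseteq> S"
  shows "spatial_weight V \<theta> L \<Lambda>
       = (\<Prod>x\<in>S. multiset_weight (\<lambda>j. ennreal (\<theta> j / real j) * boltzmann V L j x) (\<Lambda> x))"
proof -
  have "spatial_weight V \<theta> L \<Lambda>
      = Prod_any (\<lambda>x. multiset_weight (\<lambda>j. ennreal (\<theta> j / real j) * boltzmann V L j x) (\<Lambda> x))"
    unfolding spatial_weight_def
    using assms(1) by (subst Prod_any_eq_multiset_weight) (auto simp: integer_partition_def)
  also have "\<dots> = (\<Prod>x\<in>S. multiset_weight (\<lambda>j. ennreal (\<theta> j / real j) * boltzmann V L j x) (\<Lambda> x))"
  proof (rule Prod_any.expand_superset[OF assms(2)])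
    show "{x. multiset_weight (\<lambda>j. ennreal (\<theta> j / real j) * boltzmann V L j x) (\<Lambda> x) \<noteq> 1} \<subseteq> S"
      using assms(3) by force
  qed
  finally show ?thesis .
qed

lemma emeasure_spatial_measure:
  assumes "A \<subseteq> spatial_partitions n"
  shows "emeasure (spatial_measure V \<theta> L n) A
       = 1 / partition_function V \<theta> L n * (\<Sum>\<^sub>\<infinity>\<Lambda>\<in>A. spatial_weight V \<theta> L \<Lambda>)"
proof -
  let ?f = "\<lambda>\<Lambda>. 1 / partition_function V \<theta> L n * spatial_weight V \<theta> L \<Lambda>"
  have "emeasure (spatial_measure V \<theta> L n) A
      = (\<Sum>\<^sub>\<infinity>\<Lambda>\<in>spatial_partitions n. ?f \<Lambda> * indicator A \<Lambda>)"
    using assms unfolding spatial_measure_def point_measure_def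
    by (subst emeasure_density) (auto simp: nn_integral_count_space_eq_infsum)
  also have "\<dots> = (\<Sum>\<^sub>\<infinity>\<Lambda>\<in>A. ?f \<Lambda>)"
    by (rule infsum_cong_neutral) (use assms in auto)
  finally show ?thesis
    by (simp only: infsum_cmult_ennreal)
qed

section \<open>The two marginals\<close>

text \<open>
  Prescribed site masses restrict the rows \<open>\<Lambda> x\<close> independently of each other. Sites of mass 0 only
  contribute factors 1, which leaves a finite product.
\<close>

lemma infsum_spatial_weight_site_masses:
  fixes V :: "real ^ 'd::finite \<Rightarrow> ereal" and \<eta> :: "int ^ 'd \<Rightarrow> nat"
  assumes "(\<eta> has_sum n) UNIV"
  shows "(\<Sum>\<^sub>\<infinity>\<Lambda> | \<Lambda> \<in> spatial_partitions n \<and> (\<forall>x. site_mass \<Lambda> x = \<eta> x). spatial_weight V \<theta> L \<Lambda>)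
       = Prod_any (\<lambda>x. h_weight \<theta> (\<eta> x) * boltzmann V L (\<eta> x) x)"
proof -
  define S where "S = {x. \<eta> x \<noteq> 0}"
  define t where "t = (\<lambda>j. ennreal (\<theta> j / real j))"
  define P where "P = (\<lambda>m. {p. integer_partition p \<and> \<Sum>\<^sub># p = m})"
  have S: "finite S"
    using assms by (simp add: has_sum_nat_iff S_def)
  have families: "{\<Lambda>. \<Lambda> \<in> spatial_partitions n \<and> (\<forall>x. site_mass \<Lambda> x = \<eta> x)}
      = {\<Lambda>. (\<forall>x\<in>S. \<Lambda> x \<in> P (\<eta> x)) \<and> (\<forall>x. x \<notin> S \<longrightarrow> \<Lambda> x = {#})}" (is "?A = ?B")
  proof (intro equalityI subsetI)
    fix \<Lambda> assume "\<Lambda> \<in> ?A"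
    then have "integer_partition (\<Lambda> x)" "\<Sum>\<^sub># (\<Lambda> x) = \<eta> x" for x
      by (simp_all add: spatial_partitions_def site_mass_eq)
    moreover from this have "\<Lambda> x = {#}" if "x \<notin> S" for x
      using that sum_mset_eq_0_iff_integer_partition[of "\<Lambda> x"] by (simp only: S_def) simp
    ultimately show "\<Lambda> \<in> ?B"
      by (simp add: P_def)
  next
    fix \<Lambda> assume "\<Lambda> \<in> ?B"
    then have "integer_partition (\<Lambda> x) \<and> \<Sum>\<^sub># (\<Lambda> x) = \<eta> x" for x
      by (cases "x \<in> S") (auto simp: P_def S_def integer_partition_def)
    then show "\<Lambda> \<in> ?A"
      using assms by (simp add: spatial_partitions_def site_mass_eq)
  qed
  have "(\<Sum>\<^sub>\<infinity>\<Lambda>\<in>?A. spatial_weight V \<theta> L \<Lambda>)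
      = (\<Sum>\<^sub>\<infinity>\<Lambda>\<in>?B. \<Prod>x\<in>S. multiset_weight (\<lambda>j. t j * boltzmann V L j x) (\<Lambda> x))"
    unfolding families
  proof (rule infsum_cong)
    fix \<Lambda> assume "\<Lambda> \<in> ?B"
    then have "\<Lambda> \<in> ?A" "{x. \<Lambda> x \<noteq> {#}} \<subseteq> S"
      unfolding families by auto
    then show "spatial_weight V \<theta> L \<Lambda>
        = (\<Prod>x\<in>S. multiset_weight (\<lambda>j. t j * boltzmann V L j x) (\<Lambda> x))"
      unfolding t_def using S by (intro spatial_weight_eq) (auto simp: spatial_partitions_def)
  qed
  also have "\<dots> = (\<Prod>x\<in>S. \<Sum>\<^sub>\<infinity>p\<in>P (\<eta> x). multiset_weight (\<lambda>j. t j * boltzmann V L j x) p)"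
    by (rule infsum_prod_families_ennreal[OF S])
  also have "\<dots> = (\<Prod>x\<in>S. h_weight \<theta> (\<eta> x) * boltzmann V L (\<eta> x) x)"
  proof (rule prod.cong)
    \<comment> \<open>The Boltzmann factor is constant on the partitions of \<open>\<eta> x\<close> and can be taken out of the sum.\<close>
    fix x
    define b where "b = boltzmann V L 1 x"
    have b: "boltzmann V L j x = b ^ j" for j
      unfolding b_def by (rule boltzmann_power)
    have "multiset_weight (\<lambda>j. t j * boltzmann V L j x) p = boltzmann V L (\<eta> x) x * multiset_weight t p"
      if "p \<in> P (\<eta> x)" for p
      using that multiset_weight_mult_power[of t b "\<lambda>j. j" p]
      by (simp add: b P_def mult.commute)
    then have "(\<Sum>\<^sub>\<infinity>p\<in>P (\<eta> x). multiset_weight (\<lambda>j. t j * boltzmann V L j x) p)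
        = boltzmann V L (\<eta> x) x * (\<Sum>\<^sub>\<infinity>p\<in>P (\<eta> x). multiset_weight t p)"
      by (simp add: infsum_cmult_ennreal cong: infsum_cong)
    then show "(\<Sum>\<^sub>\<infinity>p\<in>P (\<eta> x). multiset_weight (\<lambda>j. t j * boltzmann V L j x) p)
        = h_weight \<theta> (\<eta> x) * boltzmann V L (\<eta> x) x"
      by (simp add: h_weight_eq P_def t_def finite_integer_partitions mult.commute)
  qed simp
  also have "\<dots> = Prod_any (\<lambda>x. h_weight \<theta> (\<eta> x) * boltzmann V L (\<eta> x) x)"
  proof (rule Prod_any.expand_superset[OF S, symmetric])
    have "h_weight \<theta> (\<eta> x) * boltzmann V L (\<eta> x) x = 1" if "x \<notin> S" for x
      using that by (simp add: S_def h_weight_0 boltzmann_0)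
    then show "{x. h_weight \<theta> (\<eta> x) * boltzmann V L (\<eta> x) x \<noteq> 1} \<subseteq> S"
      by blast
  qed
  finally show ?thesis .
qed

text \<open>
  Prescribed part counts restrict the columns independently of each other: column \<open>j\<close> is any multiset of
  \<open>r j\<close> sites. Summing the mass by columns gives \<open>\<Sum>\<^sub>j j r\<^sub>j = n\<close>, so every such choice of
  columns is a spatial partition of \<open>n\<close>. Column 0 is empty because 0 is not a part, which is why \<open>J\<close> starts
  at 1.
\<close>

lemma bij_betw_transpose_spatial_partitions:
  fixes r :: "nat \<Rightarrow> nat"
  assumes "((\<lambda>j. j * r j) has_sum n) {1..}"
  defines "J \<equiv> {j\<in>{1..}. r j \<noteq> 0}"
  shows "bij_betw transpose_mset
     {\<Lambda> :: int ^ 'd::finite \<Rightarrow> nat multiset. \<Lambda> \<in> spatial_partitions n \<and> (\<forall>j\<ge>1. total_count \<Lambda> j = r j)}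
     {M. (\<forall>j\<in>J. M j \<in> {m. size m = r j}) \<and> (\<forall>j. j \<notin> J \<longrightarrow> M j = {#})}"
    (is "bij_betw _ ?A ?B")
proof (rule bij_betw_byWitness[where f' = transpose_mset])
  have J: "finite J" and sum_r: "(\<Sum>j\<in>J. j * r j) = n"
  proof -
    have "{j\<in>{1..}. j * r j \<noteq> 0} = J"
      by (auto simp: J_def)
    then show "finite J" "(\<Sum>j\<in>J. j * r j) = n"
      using assms(1) by (simp_all add: has_sum_nat_iff)
  qed
  have finA: "finite {x. \<Lambda> x \<noteq> {#}}" if "\<Lambda> \<in> ?A" for \<Lambda>
    using that by (simp add: spatial_partitions_iff)
  have finB: "finite {j. M j \<noteq> {#}}" if "M \<in> ?B" for M :: "nat \<Rightarrow> (int ^ 'd) multiset"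
    by (rule finite_subset[OF _ J]) (use that in auto)
  show "\<forall>\<Lambda>\<in>?A. transpose_mset (transpose_mset \<Lambda>) = \<Lambda>"
    using finA transpose_transpose_mset by blast
  show "\<forall>M\<in>?B. transpose_mset (transpose_mset M) = M"
    using finB transpose_transpose_mset by blast
  show "transpose_mset ` ?A \<subseteq> ?B"
  proof (rule image_subsetI)
    fix \<Lambda> :: "int ^ 'd \<Rightarrow> nat multiset" assume \<Lambda>: "\<Lambda> \<in> ?A"
    have size: "size (transpose_mset \<Lambda> j) = r j" if "j \<ge> 1" for j
      using \<Lambda> that by (simp add: total_count_eq[OF finA[OF \<Lambda>]])
    have "transpose_mset \<Lambda> 0 = {#}"
      using \<Lambda> by (intro multiset_eqI)
        (simp add: count_transpose_mset[OF finA[OF \<Lambda>]] spatial_partitions_def integer_partition_def count_eq_zero_iff)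
    then have "transpose_mset \<Lambda> j = {#}" if "j \<notin> J" for j
      using that size[of j] by (cases "j = 0") (auto simp: J_def)
    then show "transpose_mset \<Lambda> \<in> ?B"
      using size by (simp add: J_def)
  qed
  show "transpose_mset ` ?B \<subseteq> ?A"
  proof (rule image_subsetI)
    fix M :: "nat \<Rightarrow> (int ^ 'd) multiset" assume M: "M \<in> ?B"
    note count = count_transpose_mset[OF finB[OF M]]
    note fin = finite_support_transpose_mset[OF finB[OF M]]
    have size: "size (M j) = r j" if "j \<ge> 1" for j
      using M that by (cases "j \<in> J") (auto simp: J_def)
    have parts: "set_mset (transpose_mset M x) \<subseteq> J" for x
      using M count by (auto simp flip: count_greater_zero_iff)
    have sites: "set_mset (M j) \<subseteq> {x. transpose_mset M x \<noteq> {#}}" for j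
    proof
      fix x assume "x \<in># M j"
      then have "j \<in># transpose_mset M x"
        by (simp add: count flip: count_greater_zero_iff)
      then show "x \<in> {x. transpose_mset M x \<noteq> {#}}"
        by auto
    qed
    \<comment> \<open>Double counting of the total mass, by sites and by part sizes.\<close>
    have "(\<Sum>x | transpose_mset M x \<noteq> {#}. \<Sum>\<^sub># (transpose_mset M x))
        = (\<Sum>x | transpose_mset M x \<noteq> {#}. \<Sum>j\<in>J. j * count (M j) x)"
      using sum_mset_eq_sum_count[OF J parts, of "\<lambda>j. j"] by (simp add: count)
    also have "\<dots> = (\<Sum>j\<in>J. \<Sum>x | transpose_mset M x \<noteq> {#}. j * count (M j) x)"
      by (rule sum.swap)
    also have "\<dots> = (\<Sum>j\<in>J. j * size (M j))"
      using sum_mset_eq_sum_count[OF fin sites, of "\<lambda>_. 1"]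
      by (simp flip: sum_distrib_left size_eq_sum_mset)
    also have "\<dots> = n"
      using M sum_r by simp
    finally have "(\<Sum>x | transpose_mset M x \<noteq> {#}. \<Sum>\<^sub># (transpose_mset M x)) = n" .
    moreover have "integer_partition (transpose_mset M x)" for x
      using parts[of x] by (auto simp: integer_partition_def J_def)
    ultimately have "transpose_mset M \<in> spatial_partitions n"
      using fin by (simp add: spatial_partitions_iff)
    then show "transpose_mset M \<in> ?A"
      using size by (simp add: total_count_eq[OF fin] transpose_transpose_mset[OF finB[OF M]])
  qed
qed

text \<open>
  Transposition turns the sum into one over independent columns, and the multinomial theorem evaluates
  the sum over each column.
\<close>

lemma infsum_spatial_weight_part_counts:
  fixes V :: "real ^ 'd::finite \<Rightarrow> ereal" and r :: "nat \<Rightarrow> nat"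
  assumes "((\<lambda>j. j * r j) has_sum n) {1..}"
  shows "(\<Sum>\<^sub>\<infinity>\<Lambda> | \<Lambda> \<in> spatial_partitions n \<and> (\<forall>j\<ge>1. total_count \<Lambda> j = r j). spatial_weight V \<theta> L \<Lambda>)
       = Prod_any (\<lambda>j. if j \<ge> 1
             then 1 / of_nat (fact (r j)) *
                  (ennreal (\<theta> j / real j) * (\<Sum>\<^sub>\<infinity>x. boltzmann V L j x)) ^ r j
             else 1)"
    (is "infsum _ ?A = Prod_any ?R")
proof -
  define J where "J = {j\<in>{1..}. r j \<noteq> 0}"
  define w where "w = (\<lambda>x j. ennreal (\<theta> j / real j) * boltzmann V L j x)"
  let ?B = "{M :: nat \<Rightarrow> (int ^ 'd) multiset.
    (\<forall>j\<in>J. M j \<in> {m. size m = r j}) \<and> (\<forall>j. j \<notin> J \<longrightarrow> M j = {#})}"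
  have bij: "bij_betw transpose_mset ?A ?B"
    unfolding J_def by (rule bij_betw_transpose_spatial_partitions[OF assms])
  have "{j\<in>{1..}. j * r j \<noteq> 0} = J"
    by (auto simp: J_def)
  then have J: "finite J"
    using assms by (simp add: has_sum_nat_iff)
  have "(\<Sum>\<^sub>\<infinity>\<Lambda>\<in>?A. spatial_weight V \<theta> L \<Lambda>)
      = (\<Sum>\<^sub>\<infinity>\<Lambda>\<in>?A. \<Prod>j\<in>J. multiset_weight (\<lambda>x. w x j) (transpose_mset \<Lambda> j))"
  proof (rule infsum_cong)
    fix \<Lambda> assume \<Lambda>: "\<Lambda> \<in> ?A"
    then have part: "integer_partition (\<Lambda> x)" and fin: "finite {x. \<Lambda> x \<noteq> {#}}" for x
      by (simp_all add: spatial_partitions_iff)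
    have "transpose_mset \<Lambda> \<in> ?B"
      using bij \<Lambda> by (rule bij_betwE[THEN bspec])
    then have "{j. transpose_mset \<Lambda> j \<noteq> {#}} \<subseteq> J"
      by blast
    then have "(\<Prod>x | \<Lambda> x \<noteq> {#}. multiset_weight (w x) (\<Lambda> x))
        = (\<Prod>j\<in>J. multiset_weight (\<lambda>x. w x j) (transpose_mset \<Lambda> j))"
      using fin J by (intro prod_multiset_weight_transpose) auto
    then show "spatial_weight V \<theta> L \<Lambda>
        = (\<Prod>j\<in>J. multiset_weight (\<lambda>x. w x j) (transpose_mset \<Lambda> j))"
      using spatial_weight_eq[OF part fin order_refl, of V \<theta> L] by (simp add: w_def)
  qed
  also have "\<dots> = (\<Sum>\<^sub>\<infinity>M\<in>?B. \<Prod>j\<in>J. multiset_weight (\<lambda>x. w x j) (M j))"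
    by (rule infsum_reindex_bij_betw[OF bij])
  also have "\<dots> = (\<Prod>j\<in>J. \<Sum>\<^sub>\<infinity>m | size m = r j. multiset_weight (\<lambda>x. w x j) m)"
    by (rule infsum_prod_families_ennreal[OF J])
  also have "\<dots> = (\<Prod>j\<in>J. ?R j)"
    by (rule prod.cong) (simp_all add: infsum_multiset_weight_size w_def infsum_cmult_ennreal J_def)
  also have "\<dots> = Prod_any ?R"
  proof (rule Prod_any.expand_superset[OF J, symmetric])
    have "?R j = 1" if "j \<notin> J" for j
      using that by (cases "r j = 0") (simp_all add: J_def)
    then show "{j. ?R j \<noteq> 1} \<subseteq> J"
      by blast
  qed
  finally show ?thesis .
qed

theorem proposition2p1:
  fixes V :: "real ^ 'd::finite \<Rightarrow> ereal"
    and \<theta> :: "nat \<Rightarrow> real"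
    and L :: real
    and n :: nat
  assumes "\<forall>y. V y \<noteq> -\<infinity>"
    and "\<forall>j\<ge>1. 0 \<le> \<theta> j"
    and "L > 0"
    and "n \<ge> 1"
    and "partition_function V \<theta> L n \<noteq> 0"
    and "partition_function V \<theta> L n \<noteq> \<infinity>"
  shows
    "(\<forall>\<eta> :: int ^ 'd \<Rightarrow> nat. (\<eta> has_sum n) UNIV \<longrightarrow>
        emeasure (spatial_measure V \<theta> L n)
          {\<Lambda> \<in> spatial_partitions n. \<forall>x. site_mass \<Lambda> x = \<eta> x}
        = 1 / partition_function V \<theta> L n *
          Prod_any (\<lambda>x. h_weight \<theta> (\<eta> x) * boltzmann V L (\<eta> x) x)) \<and>
     (\<forall>r :: nat \<Rightarrow> nat. ((\<lambda>j. j * r j) has_sum n) {1..} \<longrightarrow>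
        emeasure (spatial_measure V \<theta> L n)
          {\<Lambda> \<in> spatial_partitions n. \<forall>j\<ge>1. total_count \<Lambda> j = r j}
        = 1 / partition_function V \<theta> L n *
          Prod_any (\<lambda>j. if j \<ge> 1
             then 1 / of_nat (fact (r j)) *
                  (ennreal (\<theta> j / real j) * (\<Sum>\<^sub>\<infinity>x. boltzmann V L j x)) ^ r j
             else 1))"
proof (intro conjI allI impI)
  fix \<eta> :: "int ^ 'd \<Rightarrow> nat" assume "(\<eta> has_sum n) UNIV"
  then show "emeasure (spatial_measure V \<theta> L n)
        {\<Lambda> \<in> spatial_partitions n. \<forall>x. site_mass \<Lambda> x = \<eta> x}
      = 1 / partition_function V \<theta> L n *
        Prod_any (\<lambda>x. h_weight \<theta> (\<eta> x) * boltzmann V L (\<eta> x) x)"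
    by (subst emeasure_spatial_measure) (auto simp: infsum_spatial_weight_site_masses)
next
  fix r :: "nat \<Rightarrow> nat" assume "((\<lambda>j. j * r j) has_sum n) {1..}"
  then show "emeasure (spatial_measure V \<theta> L n)
        {\<Lambda> \<in> spatial_partitions n. \<forall>j\<ge>1. total_count \<Lambda> j = r j}
      = 1 / partition_function V \<theta> L n *
        Prod_any (\<lambda>j. if j \<ge> 1
           then 1 / of_nat (fact (r j)) *
                (ennreal (\<theta> j / real j) * (\<Sum>\<^sub>\<infinity>x. boltzmann V L j x)) ^ r j
           else 1)"
    by (subst emeasure_spatial_measure) (auto simp only: infsum_spatial_weight_part_counts)
qed

end
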